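(* If $k$ is a positive integer, then \[R^{top}(\omega+1,k+1)=R^{cl}(\omega+1,k+1)=\omega^k+1.\]
   Context: All arithmetic operations on ordinals are in the ordinal sense. Every ordinal is identified with the set of smaller ordinals and carries the order topology; subsets carry the subspace topology. A set $X$ of ordinals is order-homeomorphic to an ordinal $\alpha$ (a closed copy of $\alpha$) if there is a bijection $X\to\alpha$ that is both an order-isomorphism and a homeomorphism; equivalently, $X$ is order-isomorphic to $\alpha$ and closed in its supremum. $[X]^2$ is the set of $2$-element subsets of $X$. For an ordinal $\alpha$ and a positive integer $k$, $R^{top}(\alpha,k)$ (respectively $R^{cl}(\alpha,k)$) is the least ordinal $\beta$ such that for every coloring $c:[\beta]^2\to\{\text{red},\text{blue}\}$ either there is $X\subseteq\beta$ homeomorphic (respectively order-homeomorphic) to $\alpha$ with all elements of $[X]^2$ red, or there is a $k$-element $Y\subseteq\beta$ with all elements of $[Y]^2$ blue. *)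

theory Defs
  imports
    "HOL-Analysis.Analysis"
    "HOL-Library.Ramsey"
    "HOL-Library.Infinite_Typeclass"
begin

no_notation elt_set_eq (infix "=o" 50)
unbundle cardinal_syntax

section \<open>Ordinals\<close>

text \<open>
  An ordinal is an isomorphism class of well-orders. The type below consists of the order types
  of all well-orders of subsets of the type \<open>'a\<close>. For infinite \<open>'a\<close> these are
  exactly the ordinals below the successor cardinal of the cardinality of \<open>'a\<close>, so that
  statements that are polymorphic in \<open>'a :: infinite\<close> speak about arbitrarily large ordinals.
  The set of ordinals smaller than \<open>\<beta>\<close>, with which \<open>\<beta>\<close> is identified, is
  \<open>{..<\<beta>}\<close>.
\<close>

quotient_type 'a ordinal = "'a rel" / partial: "\<lambda>r s. r =o s"
proof (rule part_equivpI)
  show "\<exists>r :: 'a rel. r =o r"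
    using card_of_refl by blast
  show "symp (\<lambda>r s :: 'a rel. r =o s)"
    by (auto intro!: sympI ordIso_symmetric)
  show "transp (\<lambda>r s :: 'a rel. r =o s)"
    by (auto intro!: transpI intro: ordIso_transitive)
qed

lemma ordIso_Well_order: "r =o s \<Longrightarrow> Well_order r \<and> Well_order s"
  by (simp add: ordIso_def)

instantiation ordinal :: (type) linorder
begin

lift_definition less_eq_ordinal :: "'a ordinal \<Rightarrow> 'a ordinal \<Rightarrow> bool" is "\<lambda>r s. r \<le>o s"
  by (meson ordIso_ordLeq_trans ordIso_symmetric ordLeq_ordIso_trans)

lift_definition less_ordinal :: "'a ordinal \<Rightarrow> 'a ordinal \<Rightarrow> bool" is "\<lambda>r s. r <o s"
  by (meson ordIso_ordLess_trans ordIso_symmetric ordLess_ordIso_trans)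

instance
proof
  fix x y z :: "'a ordinal"
  show "x < y \<longleftrightarrow> x \<le> y \<and> \<not> y \<le> x"
    by transfer (metis not_ordLess_ordLeq ordIso_Well_order ordLess_imp_ordLeq
        not_ordLeq_iff_ordLess)
  show "x \<le> x"
    by transfer (simp add: ordIso_imp_ordLeq)
  show "x \<le> y \<Longrightarrow> y \<le> z \<Longrightarrow> x \<le> z"
    by transfer (rule ordLeq_transitive)
  show "x \<le> y \<Longrightarrow> y \<le> x \<Longrightarrow> x = y"
    by transfer (simp add: ordIso_iff_ordLeq)
  show "x \<le> y \<or> y \<le> x"
    by transfer (metis ordIso_Well_order ordLeq_total)
qed

end

instance ordinal :: (type) wellorder
proof
  fix P :: "'a ordinal \<Rightarrow> bool" and x
  assume step: "\<And>x. (\<And>y. y < x \<Longrightarrow> P y) \<Longrightarrow> P x"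
  have "\<forall>x. rep_ordinal x = r \<longrightarrow> P x" for r
  proof (induction r rule: wf_induct_rule[OF wf_ordLess])
    case (1 r)
    show ?case
      by (metis "1" less_ordinal.rep_eq step)
  qed
  then show "P x"
    by blast
qed

text \<open>
  The order topology. As \<open>{..<\<beta>}\<close> is an initial segment, the topology it inherits as
  a subspace is the order topology of the ordinal \<open>\<beta>\<close>.
\<close>

instantiation ordinal :: (type) linorder_topology
begin

definition open_ordinal :: "'a ordinal set \<Rightarrow> bool" where
  "open_ordinal = generate_topology (range (\<lambda>a. {..<a}) \<union> range (\<lambda>a. {a<..}))"

instance
  by standard (rule open_ordinal_def)

end

lemma Well_order_rep_ordinal: "Well_order (rep_ordinal \<alpha>)"
  using Quotient3_rep_reflp[OF Quotient3_ordinal] ordIso_Well_order by blast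

lemma ordinal_iso_initial_segment:
  fixes \<alpha> \<beta> :: "'a ordinal"
  shows "\<alpha> < \<beta> \<longleftrightarrow> (\<exists>a \<in> Field (rep_ordinal \<beta>).
           rep_ordinal \<alpha> =o Restr (rep_ordinal \<beta>) (underS (rep_ordinal \<beta>) a))"
  unfolding less_ordinal.rep_eq
  by (rule ordLess_iff_ordIso_Restr) (rule Well_order_rep_ordinal)+

lemma card_of_lessThan_ordinal: "|{..<\<beta> :: 'a ordinal}| \<le>o |UNIV :: 'a set|"
proof -
  let ?r = "rep_ordinal \<beta>"
  have "\<forall>\<alpha>\<in>{..<\<beta>}. \<exists>a. rep_ordinal \<alpha> =o Restr ?r (underS ?r a)"
    using ordinal_iso_initial_segment[of _ \<beta>] by blast
  then obtain g where g: "\<forall>\<alpha>\<in>{..<\<beta>}. rep_ordinal \<alpha> =o Restr ?r (underS ?r (g \<alpha>))"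
    by (rule bchoice[THEN exE])
  have "inj_on g {..<\<beta>}"
  proof (rule inj_onI)
    fix x y
    assume "x \<in> {..<\<beta>}" "y \<in> {..<\<beta>}" "g x = g y"
    then have "rep_ordinal x =o rep_ordinal y"
      by (metis g ordIso_symmetric ordIso_transitive)
    then show "x = y"
      by (simp add: Quotient3_rel_rep[OF Quotient3_ordinal])
  qed
  then show ?thesis
    by (metis card_of_ordLeq subset_UNIV)
qed

lemma no_injection_ordinal: "\<nexists>j :: 'a ordinal \<Rightarrow> 'a. inj j"
proof
  assume "\<exists>j :: 'a ordinal \<Rightarrow> 'a. inj j"
  then obtain j :: "'a ordinal \<Rightarrow> 'a" where j: "inj j"
    by blast
  define r where "r = dir_image {(x, y :: 'a ordinal). x \<le> y} j"
  have fld: "Field {(x, y :: 'a ordinal). x \<le> y} = UNIV"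
    by (auto simp: Field_def)
  have wo: "Well_order {(x, y :: 'a ordinal). x \<le> y}"
  proof -
    have "{(x, y :: 'a ordinal). x \<le> y} - Id = {(x, y). x < y}"
      by auto
    moreover have "Linear_order {(x, y :: 'a ordinal). x \<le> y}"
      unfolding fld
      by (auto simp: linear_order_on_def partial_order_on_def preorder_on_def
          refl_on_def trans_def antisym_def total_on_def)
    ultimately show ?thesis
      by (simp add: well_order_on_def wf)
  qed
  have r: "Well_order r"
    unfolding r_def by (rule Well_order_dir_image[OF wo]) (use j fld in simp)
  have mem: "(j x, j y) \<in> r \<longleftrightarrow> x \<le> y" for x y
    using j by (auto simp: r_def dir_image_def inj_eq)
  have fr: "j x \<in> Field r" for x
    using mem[of x x] by (auto simp: Field_def)
  let ?seg = "\<lambda>x. Restr r (underS r (j x))"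
  have wseg: "Well_order (?seg x)" for x
    by (simp add: Well_order_Restr r)
  let ?f = "\<lambda>x. abs_ordinal (?seg x)"
  have repabs: "rep_ordinal (abs_ordinal s) =o s" if "Well_order s" for s :: "'a rel"
    using that by (metis Quotient3_ordinal ordIso_reflexive rep_abs_rsp_left)
  have lt: "?seg x <o ?seg y" if "x < y" for x y
  proof -
    have "underS r (j x) \<subset> underS r (j y)"
    proof -
      have "j x \<in> underS r (j y)"
        using that mem j by (auto simp: underS_def inj_eq)
      moreover have "j x \<notin> underS r (j x)"
        by (auto simp: underS_def)
      moreover have "underS r (j x) \<subseteq> underS r (j y)"
        using r that mem by (metis order_less_imp_le underS_incr well_order_on_def
            linear_order_on_def partial_order_on_def preorder_on_def)
      ultimately show ?thesis
        by blast
    qed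
    then show ?thesis
      using r ofilter_subset_ordLess[OF r] wo_rel.underS_ofilter[of r]
      by (simp add: wo_rel_def)
  qed
  have "?f x < ?f y" if "x < y" for x y
    unfolding less_ordinal.rep_eq using lt[OF that] repabs wseg
    by (meson ordIso_ordLess_trans ordIso_symmetric ordLess_ordIso_trans)
  then have "x \<le> ?f x" for x
    by (induction x rule: less_induct) (metis not_le order_less_imp_not_less)
  moreover have "?f (abs_ordinal r) < abs_ordinal r"
    unfolding less_ordinal.rep_eq using r fr repabs wseg
    by (metis empty_iff ordIso_ordLess_trans ordIso_symmetric ordLess_ordIso_trans
        underS_Restr_ordLess)
  ultimately show False
    by (meson not_le)
qed

lemma ordinal_strict_upper_bound:
  fixes f :: "'b \<Rightarrow> 'a::infinite ordinal"
  assumes "|A| \<le>o |UNIV :: 'a set|"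
  shows "\<exists>\<gamma>. \<forall>x\<in>A. f x < \<gamma>"
proof (rule ccontr)
  assume "\<not> ?thesis"
  then have "(\<Union>x\<in>A. {..<f x} \<union> {f x}) = UNIV"
    by (auto simp: set_eq_iff) (metis not_less_iff_gr_or_eq)
  moreover have "|\<Union>x\<in>A. {..<f x} \<union> {f x}| \<le>o |UNIV :: 'a set|"
  proof (rule card_of_UNION_ordLeq_infinite)
    show "infinite (UNIV :: 'a set)"
      by (rule infinite_UNIV)
    have "|{f x}| \<le>o |UNIV :: 'a set|" for x
      by (rule card_of_singl_ordLeq) simp
    then show "\<forall>x\<in>A. |{..<f x} \<union> {f x}| \<le>o |UNIV :: 'a set|"
      using card_of_Un_ordLeq_infinite_Field[of "|UNIV :: 'a set|"]
        infinite_UNIV[where 'a = 'a] card_of_lessThan_ordinal[where 'a = 'a]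
      by (auto simp: Field_card_of card_of_card_order_on simp del: Un_insert_right)
  qed (rule assms)
  ultimately have "|UNIV :: 'a ordinal set| \<le>o |UNIV :: 'a set|"
    by simp
  then show False
    using no_injection_ordinal by (metis card_of_ordLeq)
qed

lemma ordinal_upper_bound_lessThan:
  fixes f :: "'a ordinal \<Rightarrow> 'a::infinite ordinal"
  shows "\<exists>\<gamma>. \<forall>\<delta><\<beta>. f \<delta> < \<gamma>"
  using ordinal_strict_upper_bound[OF card_of_lessThan_ordinal[of \<beta>], of f] by auto


section \<open>Ordinal arithmetic\<close>

text \<open>
  Ordinal sum and product by transfinite recursion on the right argument:
  \<open>\<alpha> + \<beta>\<close> is the supremum of \<open>\<alpha>\<close> and all
  \<open>(\<alpha> + \<delta>) + 1\<close>, and \<open>\<alpha> * \<beta>\<close> is the supremum of all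
  \<open>\<alpha> * \<delta> + \<alpha>\<close>, for \<open>\<delta> < \<beta>\<close>.
\<close>

instantiation ordinal :: (infinite) "{zero, one, plus, times}"
begin

definition
  "0 = (LEAST \<gamma> :: 'a ordinal. True)"

definition
  "1 = (LEAST \<gamma> :: 'a ordinal. 0 < \<gamma>)"

function plus_ordinal :: "'a ordinal \<Rightarrow> 'a ordinal \<Rightarrow> 'a ordinal" where
  "plus_ordinal \<alpha> \<beta> = (LEAST \<gamma>. \<alpha> \<le> \<gamma> \<and> (\<forall>\<delta>\<in>{..<\<beta>}. plus_ordinal \<alpha> \<delta> < \<gamma>))"
  by pat_completeness auto
termination
  by (relation "inv_image {(x, y). x < y} snd") (auto intro: wf)

declare plus_ordinal.simps [simp del]

function times_ordinal :: "'a ordinal \<Rightarrow> 'a ordinal \<Rightarrow> 'a ordinal" where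
  "times_ordinal \<alpha> \<beta> = (LEAST \<gamma>. \<forall>\<delta>\<in>{..<\<beta>}. times_ordinal \<alpha> \<delta> + \<alpha> \<le> \<gamma>)"
  by pat_completeness auto
termination
  by (relation "inv_image {(x, y). x < y} snd") (auto intro: wf)

declare times_ordinal.simps [simp del]

instance ..

end

context
  fixes \<alpha> \<beta> \<gamma> :: "'a::infinite ordinal"
begin

lemma ordinal_zero_le [simp]: "0 \<le> \<alpha>"
  by (simp add: zero_ordinal_def Least_le)

lemma ordinal_not_less_zero [simp]: "\<not> \<alpha> < 0"
  by (simp add: not_less)

lemma ordinal_add_le_iff: "\<alpha> + \<beta> \<le> \<gamma> \<longleftrightarrow> \<alpha> \<le> \<gamma> \<and> (\<forall>\<delta><\<beta>. \<alpha> + \<delta> < \<gamma>)"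
proof -
  obtain \<mu> where "\<forall>\<delta><\<beta>. \<alpha> + \<delta> < \<mu>"
    using ordinal_upper_bound_lessThan by blast
  then have "\<alpha> \<le> max \<alpha> \<mu> \<and> (\<forall>\<delta>\<in>{..<\<beta>}. \<alpha> + \<delta> < max \<alpha> \<mu>)"
    by (auto simp: less_max_iff_disj)
  then have "\<alpha> \<le> \<alpha> + \<beta> \<and> (\<forall>\<delta>\<in>{..<\<beta>}. \<alpha> + \<delta> < \<alpha> + \<beta>)"
    unfolding plus_ordinal.simps[of \<alpha> \<beta>] by (rule LeastI)
  moreover have "\<alpha> + \<beta> \<le> \<gamma>" if "\<alpha> \<le> \<gamma> \<and> (\<forall>\<delta>\<in>{..<\<beta>}. \<alpha> + \<delta> < \<gamma>)"
    unfolding plus_ordinal.simps[of \<alpha> \<beta>] using that by (rule Least_le)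
  ultimately show ?thesis
    by (meson lessThan_iff less_le_trans order_trans)
qed

lemma ordinal_mult_le_iff: "\<alpha> * \<beta> \<le> \<gamma> \<longleftrightarrow> (\<forall>\<delta><\<beta>. \<alpha> * \<delta> + \<alpha> \<le> \<gamma>)"
proof -
  obtain \<mu> where "\<forall>\<delta><\<beta>. \<alpha> * \<delta> + \<alpha> < \<mu>"
    using ordinal_upper_bound_lessThan[of \<beta> "\<lambda>\<delta>. \<alpha> * \<delta> + \<alpha>"] by blast
  then have "\<forall>\<delta>\<in>{..<\<beta>}. \<alpha> * \<delta> + \<alpha> \<le> \<mu>"
    by (auto simp: less_imp_le)
  then have "\<forall>\<delta>\<in>{..<\<beta>}. \<alpha> * \<delta> + \<alpha> \<le> \<alpha> * \<beta>"
    unfolding times_ordinal.simps[of \<alpha> \<beta>] by (rule LeastI)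
  moreover have "\<alpha> * \<beta> \<le> \<gamma>" if "\<forall>\<delta>\<in>{..<\<beta>}. \<alpha> * \<delta> + \<alpha> \<le> \<gamma>"
    unfolding times_ordinal.simps[of \<alpha> \<beta>] using that by (rule Least_le)
  ultimately show ?thesis
    by (meson lessThan_iff order_trans)
qed

end

lemma ordinal_le_antisym_iff: "\<alpha> = \<beta> \<longleftrightarrow> (\<forall>\<gamma>. \<alpha> \<le> \<gamma> \<longleftrightarrow> \<beta> \<le> \<gamma>)" for \<alpha> \<beta> :: "'a ordinal"
  by (meson order.antisym order.refl)

lemma ordinal_le_iff_less: "\<alpha> \<le> \<gamma> \<longleftrightarrow> (\<forall>\<delta><\<alpha>. \<delta> < \<gamma>)" for \<alpha> \<gamma> :: "'a ordinal"
  by (meson less_irrefl less_le_trans not_le)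

lemma ordinal_less_one_iff [simp]: "\<alpha> < 1 \<longleftrightarrow> \<alpha> = 0" for \<alpha> :: "'a::infinite ordinal"
proof -
  obtain \<mu> where "(0 :: 'a ordinal) < \<mu>"
    using ordinal_strict_upper_bound[of "{0 :: 'a ordinal}" "\<lambda>x. x"]
      card_of_singl_ordLeq[of "UNIV :: 'a set" "0 :: 'a ordinal"] by auto
  then have "(0 :: 'a ordinal) < 1"
    unfolding one_ordinal_def by (rule LeastI)
  then show ?thesis
    using not_less_Least[of \<alpha> "\<lambda>\<gamma>. 0 < \<gamma>"] ordinal_zero_le[of \<alpha>]
    by (auto simp: one_ordinal_def[symmetric])
qed

lemma ordinal_add_left_less [simp]: "\<alpha> + \<beta> < \<alpha> + \<gamma> \<longleftrightarrow> \<beta> < \<gamma>" for \<alpha> \<beta> \<gamma> :: "'a::infinite ordinal"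
  by (metis linorder_neqE order.asym order.refl ordinal_add_le_iff)

lemma ordinal_add_left_le [simp]: "\<alpha> + \<beta> \<le> \<alpha> + \<gamma> \<longleftrightarrow> \<beta> \<le> \<gamma>" for \<alpha> \<beta> \<gamma> :: "'a::infinite ordinal"
  by (simp flip: not_less)

lemma ordinal_le_add_left [simp]: "\<alpha> \<le> \<alpha> + \<beta>" for \<alpha> \<beta> :: "'a::infinite ordinal"
  using ordinal_add_le_iff by blast

lemma ordinal_less_add_iff: "\<gamma> < \<alpha> + \<beta> \<longleftrightarrow> \<gamma> < \<alpha> \<or> (\<exists>\<delta><\<beta>. \<gamma> \<le> \<alpha> + \<delta>)"
  for \<alpha> \<beta> \<gamma> :: "'a::infinite ordinal"
  using ordinal_add_le_iff[of \<alpha> \<beta> \<gamma>] by (meson not_le)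

lemma ordinal_less_mult_iff: "\<gamma> < \<alpha> * \<beta> \<longleftrightarrow> (\<exists>\<delta><\<beta>. \<gamma> < \<alpha> * \<delta> + \<alpha>)"
  for \<alpha> \<beta> \<gamma> :: "'a::infinite ordinal"
  using ordinal_mult_le_iff[of \<alpha> \<beta> \<gamma>] by (meson not_le)

lemma ordinal_less_add_one_iff [simp]: "\<gamma> < \<alpha> + 1 \<longleftrightarrow> \<gamma> \<le> \<alpha>" for \<alpha> \<gamma> :: "'a::infinite ordinal"
proof -
  have "\<alpha> + 0 = \<alpha>"
    by (subst ordinal_le_antisym_iff) (simp add: ordinal_add_le_iff)
  then show ?thesis
    by (auto simp: ordinal_less_add_iff)
qed

instance ordinal :: (infinite) monoid_add
proof
  fix \<alpha> \<beta> \<gamma> :: "'a ordinal"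
  show zr: "\<alpha> + 0 = \<alpha>" for \<alpha> :: "'a ordinal"
    by (subst ordinal_le_antisym_iff) (simp add: ordinal_add_le_iff)
  show "0 + \<alpha> = \<alpha>"
  proof (induction \<alpha> rule: less_induct)
    case (less \<alpha>)
    have "0 + \<alpha> \<le> \<mu> \<longleftrightarrow> \<alpha> \<le> \<mu>" for \<mu>
      using less by (simp add: ordinal_add_le_iff ordinal_le_iff_less[of \<alpha>])
    then show ?case
      by (subst ordinal_le_antisym_iff) blast
  qed
  show "\<alpha> + \<beta> + \<gamma> = \<alpha> + (\<beta> + \<gamma>)"
  proof (induction \<gamma> rule: less_induct)
    case (less \<gamma>)
    have "\<alpha> + \<beta> + \<gamma> \<le> \<mu> \<longleftrightarrow> \<alpha> + (\<beta> + \<gamma>) \<le> \<mu>" for \<mu>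
    proof
      assume L: "\<alpha> + \<beta> + \<gamma> \<le> \<mu>"
      then have 1: "\<alpha> + \<beta> \<le> \<mu>" "\<And>\<delta>. \<delta> < \<gamma> \<Longrightarrow> \<alpha> + (\<beta> + \<delta>) < \<mu>"
        by (auto simp: ordinal_add_le_iff[of "\<alpha> + \<beta>"] less)
      have "\<alpha> + \<epsilon> < \<mu>" if "\<epsilon> < \<beta> + \<gamma>" for \<epsilon>
        using that unfolding ordinal_less_add_iff
        by (metis 1 le_less_trans less_le_trans ordinal_add_left_le ordinal_add_left_less)
      then show "\<alpha> + (\<beta> + \<gamma>) \<le> \<mu>"
        using 1 by (meson ordinal_add_le_iff)
    next
      assume R: "\<alpha> + (\<beta> + \<gamma>) \<le> \<mu>"
      then have "\<alpha> + \<beta> \<le> \<mu>"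
        by (meson order_trans ordinal_add_left_le ordinal_le_add_left)
      moreover have "\<alpha> + \<beta> + \<delta> < \<mu>" if "\<delta> < \<gamma>" for \<delta>
        using R that less by (metis less_le_trans ordinal_add_left_less)
      ultimately show "\<alpha> + \<beta> + \<gamma> \<le> \<mu>"
        by (simp add: ordinal_add_le_iff[of "\<alpha> + \<beta>"])
    qed
    then show ?case
      by (subst ordinal_le_antisym_iff) blast
  qed
qed

lemma ordinal_distrib_left: "\<alpha> * (\<beta> + \<gamma>) = \<alpha> * \<beta> + \<alpha> * \<gamma>" for \<alpha> \<beta> \<gamma> :: "'a::infinite ordinal"
proof (induction \<gamma> rule: less_induct)
  case (less \<gamma>)
  have mono: "\<alpha> * \<delta> + \<alpha> \<le> \<alpha> * \<epsilon>" if "\<delta> < \<epsilon>" for \<delta> \<epsilon>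
    using that ordinal_mult_le_iff by blast
  have "\<alpha> * (\<beta> + \<gamma>) \<le> \<mu> \<longleftrightarrow> \<alpha> * \<beta> + \<alpha> * \<gamma> \<le> \<mu>" for \<mu>
  proof
    assume L: "\<alpha> * (\<beta> + \<gamma>) \<le> \<mu>"
    have "\<alpha> * \<beta> \<le> \<alpha> * (\<beta> + \<gamma>)"
      by (metis mono order.refl order.trans ordinal_le_add_left order.order_iff_strict)
    moreover have "\<alpha> * \<beta> + \<xi> < \<mu>" if "\<xi> < \<alpha> * \<gamma>" for \<xi>
    proof -
      obtain \<delta> where d: "\<delta> < \<gamma>" "\<xi> < \<alpha> * \<delta> + \<alpha>"
        using \<open>\<xi> < \<alpha> * \<gamma>\<close> ordinal_less_mult_iff by blast
      then have "\<alpha> * \<beta> + \<xi> < \<alpha> * \<beta> + (\<alpha> * \<delta> + \<alpha>)"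
        by simp
      also have "\<dots> = \<alpha> * (\<beta> + \<delta>) + \<alpha>"
        using less d by (simp add: add.assoc)
      also have "\<dots> \<le> \<mu>"
        using d L mono[of "\<beta> + \<delta>" "\<beta> + \<gamma>"] by simp
      finally show ?thesis .
    qed
    ultimately show "\<alpha> * \<beta> + \<alpha> * \<gamma> \<le> \<mu>"
      using L by (auto simp: ordinal_add_le_iff)
  next
    assume R: "\<alpha> * \<beta> + \<alpha> * \<gamma> \<le> \<mu>"
    have "\<alpha> * \<epsilon> + \<alpha> \<le> \<mu>" if "\<epsilon> < \<beta> + \<gamma>" for \<epsilon>
    proof (cases "\<epsilon> < \<beta>")
      case True
      then show ?thesis
        using R mono ordinal_le_add_left by (meson order_trans)
    next
      case False
      then obtain \<delta> where d: "\<delta> < \<gamma>" "\<beta> + \<delta> = \<epsilon>"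
      proof -
        define \<delta> where "\<delta> = (LEAST \<delta>. \<epsilon> \<le> \<beta> + \<delta>)"
        obtain \<delta>' where d': "\<delta>' < \<gamma>" "\<epsilon> \<le> \<beta> + \<delta>'"
          using that \<open>\<epsilon> < \<beta> + \<gamma>\<close> False ordinal_less_add_iff by blast
        then have "\<epsilon> \<le> \<beta> + \<delta>" "\<delta> \<le> \<delta>'"
          unfolding \<delta>_def by (auto intro: LeastI Least_le)
        moreover have "\<beta> + \<delta> \<le> \<epsilon>"
          unfolding ordinal_add_le_iff using False not_less_Least[of _ "\<lambda>\<delta>. \<epsilon> \<le> \<beta> + \<delta>"]
          by (auto simp: \<delta>_def not_le not_less)
        ultimately show ?thesis
          using that[of \<delta>] d' by simp
      qed
      then have "\<alpha> * \<epsilon> + \<alpha> = \<alpha> * \<beta> + (\<alpha> * \<delta> + \<alpha>)"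
        using less by (auto simp: add.assoc)
      also have "\<dots> \<le> \<alpha> * \<beta> + \<alpha> * \<gamma>"
        using d mono by simp
      finally show ?thesis
        using R by simp
    qed
    then show "\<alpha> * (\<beta> + \<gamma>) \<le> \<mu>"
      by (simp add: ordinal_mult_le_iff)
  qed
  then show ?case
    by (subst ordinal_le_antisym_iff) blast
qed

lemma ordinal_mult_zero [simp]: "\<alpha> * 0 = 0" for \<alpha> :: "'a::infinite ordinal"
  by (intro order.antisym) (simp_all add: ordinal_mult_le_iff)

instance ordinal :: (infinite) monoid_mult
proof
  fix \<alpha> \<beta> \<gamma> :: "'a ordinal"
  show r1: "\<alpha> * 1 = \<alpha>" for \<alpha> :: "'a ordinal"
    by (subst ordinal_le_antisym_iff) (simp add: ordinal_mult_le_iff)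
  have add_one_le: "\<delta> + 1 \<le> \<mu> \<longleftrightarrow> \<delta> < \<mu>" for \<delta> \<mu> :: "'a ordinal"
    by (metis not_le ordinal_less_add_one_iff)
  show "1 * \<alpha> = \<alpha>"
  proof (induction \<alpha> rule: less_induct)
    case (less \<alpha>)
    have "1 * \<alpha> \<le> \<mu> \<longleftrightarrow> \<alpha> \<le> \<mu>" for \<mu>
      using less add_one_le
      by (simp add: ordinal_mult_le_iff[of 1] ordinal_le_iff_less[of \<alpha>])
    then show ?case
      by (subst ordinal_le_antisym_iff) blast
  qed
  have mono: "\<alpha> * \<delta> \<le> \<alpha> * \<epsilon>" if "\<delta> \<le> \<epsilon>" for \<alpha> \<delta> \<epsilon> :: "'a ordinal"
    by (metis that order.order_iff_strict order.trans ordinal_le_add_left ordinal_mult_le_iff)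
  show "\<alpha> * \<beta> * \<gamma> = \<alpha> * (\<beta> * \<gamma>)"
  proof (induction \<gamma> rule: less_induct)
    case (less \<gamma>)
    have "\<alpha> * \<beta> * \<gamma> \<le> \<mu> \<longleftrightarrow> (\<forall>\<delta><\<gamma>. \<alpha> * (\<beta> * \<delta> + \<beta>) \<le> \<mu>)" for \<mu>
      using less by (auto simp: ordinal_mult_le_iff[of "\<alpha> * \<beta>"] ordinal_distrib_left)
    moreover have "\<alpha> * (\<beta> * \<gamma>) \<le> \<mu> \<longleftrightarrow> (\<forall>\<delta><\<gamma>. \<alpha> * (\<beta> * \<delta> + \<beta>) \<le> \<mu>)" for \<mu>
      unfolding ordinal_mult_le_iff[of \<alpha>] ordinal_less_mult_iff by blast
    ultimately show ?case
      by (subst ordinal_le_antisym_iff) blast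
  qed
qed

text \<open>Finite ordinal powers are the powers \<open>\<alpha> ^ n\<close> of this monoid.\<close>

definition omega :: "'a::infinite ordinal" where
  "omega = (LEAST \<gamma>. infinite {..<\<gamma>})"


section \<open>Topological and closed Ramsey numbers\<close>

definition order_homeomorphic ::
  "'a::linorder_topology set \<Rightarrow> 'b::linorder_topology set \<Rightarrow> bool" where
  "order_homeomorphic X Y \<longleftrightarrow> (\<exists>f g. homeomorphism X Y f g \<and> strict_mono_on X f)"

datatype color = Red | Blue

text \<open>Only the values of a coloring on two-element subsets of \<open>\<beta>\<close> matter.\<close>

definition topological_ramsey :: "'a ordinal \<Rightarrow> 'a ordinal \<Rightarrow> nat \<Rightarrow> bool" where
  "topological_ramsey \<beta> \<alpha> k \<longleftrightarrow>
     (\<forall>c :: 'a ordinal set \<Rightarrow> color.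
        (\<exists>X \<subseteq> {..<\<beta>}. X homeomorphic {..<\<alpha>} \<and> (\<forall>e \<in> [X]\<^bsup>2\<^esup>. c e = Red)) \<or>
        (\<exists>Y \<in> [{..<\<beta>}]\<^bsup>k\<^esup>. \<forall>e \<in> [Y]\<^bsup>2\<^esup>. c e = Blue))"

definition closed_ramsey :: "'a ordinal \<Rightarrow> 'a ordinal \<Rightarrow> nat \<Rightarrow> bool" where
  "closed_ramsey \<beta> \<alpha> k \<longleftrightarrow>
     (\<forall>c :: 'a ordinal set \<Rightarrow> color.
        (\<exists>X \<subseteq> {..<\<beta>}. order_homeomorphic X {..<\<alpha>} \<and> (\<forall>e \<in> [X]\<^bsup>2\<^esup>. c e = Red)) \<or>
        (\<exists>Y \<in> [{..<\<beta>}]\<^bsup>k\<^esup>. \<forall>e \<in> [Y]\<^bsup>2\<^esup>. c e = Blue))"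

definition R_top :: "'a ordinal \<Rightarrow> nat \<Rightarrow> 'a ordinal" where
  "R_top \<alpha> k = (LEAST \<beta>. topological_ramsey \<beta> \<alpha> k)"

definition R_cl :: "'a ordinal \<Rightarrow> nat \<Rightarrow> 'a ordinal" where
  "R_cl \<alpha> k = (LEAST \<beta>. closed_ramsey \<beta> \<alpha> k)"

end

theory Submission
  imports Defs
begin

text \<open>
  The upper bound goes by induction on \<open>k\<close>, for all closed intervals
  \<open>[\<alpha>, \<alpha> + \<omega>\<^sup>k]\<close> at once (\<open>interval_omega_power_ramsey\<close>), so that no coloring
  ever has to be transported along an order-isomorphism. Look at the top point
  \<open>\<theta> = \<alpha> + \<omega>\<^sup>k * \<omega>\<close> of an interval for \<open>k + 1\<close>. If its red neighbours are cofinal below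
  \<open>\<theta>\<close>, choose an increasing \<open>\<omega>\<close>-sequence of them with limit \<open>\<theta>\<close>. By Ramsey's theorem it
  has a red infinite subsequence, which together with \<open>\<theta>\<close> is a red closed copy of
  \<open>\<omega> + 1\<close>, or else it contains arbitrarily large finite blue cliques. If the red
  neighbours are bounded, \<open>\<theta>\<close> is joined in blue to everything in a final segment below
  it. That segment includes an interval \<open>[\<alpha>', \<alpha>' + \<omega>\<^sup>k]\<close>, and \<open>\<theta>\<close> extends by one
  point any blue clique that the induction hypothesis yields there.

  For the lower bound, write a nonzero ordinal below \<open>\<omega>\<^sup>k\<close> in Cantor normal form and let
  its rank, which is less than \<open>k\<close>, be the last exponent. This is its Cantor--Bendixson
  rank, so the points of one rank form a discrete subspace (\<open>omega_power_rank\<close>). Color a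
  pair blue if its two ranks differ and red otherwise. A blue clique then has at most
  \<open>k\<close> points. A red set is discrete, whereas \<open>\<omega> + 1\<close> has a limit point, so no red
  set is homeomorphic to \<open>\<omega> + 1\<close>. The coloring restricts to every
  \<open>\<beta> \<le> \<omega>\<^sup>k\<close>.

  Closed copies are homeomorphic copies. Hence the upper bound for closed copies and the
  lower bound for homeomorphic ones determine both Ramsey numbers.
\<close>

section \<open>Ordinal arithmetic\<close>

lemma ordinal_add_one_le_iff: "\<alpha> + 1 \<le> \<beta> \<longleftrightarrow> \<alpha> < \<beta>" for \<alpha> \<beta> :: "'a::infinite ordinal"
  by (metis not_le ordinal_less_add_one_iff)

lemma ordinal_zero_less_iff: "0 < \<alpha> \<longleftrightarrow> \<alpha> \<noteq> 0" for \<alpha> :: "'a::infinite ordinal"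
  by (metis neq_iff ordinal_not_less_zero)

lemma ordinal_less_add_iff_pos [simp]: "\<alpha> < \<alpha> + \<beta> \<longleftrightarrow> 0 < \<beta>"
  for \<alpha> \<beta> :: "'a::infinite ordinal"
  using ordinal_add_left_less[of \<alpha> 0 \<beta>] by simp

lemma ordinal_le_add_right: "\<gamma> \<le> \<alpha> + \<gamma>" for \<alpha> \<gamma> :: "'a::infinite ordinal"
proof (induction \<gamma> rule: less_induct)
  case (less \<gamma>)
  then show ?case
    by (metis leI less_le_not_le ordinal_add_left_less)
qed

lemma ordinal_le_imp_add:
  fixes \<alpha> \<gamma> :: "'a::infinite ordinal"
  assumes "\<alpha> \<le> \<gamma>"
  obtains \<delta> where "\<gamma> = \<alpha> + \<delta>"
proof
  define \<delta> where "\<delta> = (LEAST \<delta>. \<gamma> \<le> \<alpha> + \<delta>)"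
  have "\<gamma> \<le> \<alpha> + \<delta>"
    unfolding \<delta>_def by (rule LeastI) (rule ordinal_le_add_right)
  moreover have "\<alpha> + \<epsilon> < \<gamma>" if "\<epsilon> < \<delta>" for \<epsilon>
    using not_less_Least[OF that[unfolded \<delta>_def]] by (simp add: not_le)
  then have "\<alpha> + \<delta> \<le> \<gamma>"
    using assms by (simp add: ordinal_add_le_iff)
  ultimately show "\<gamma> = \<alpha> + \<delta>"
    by (rule order.antisym)
qed

lemma ordinal_mult_add_le:
  fixes \<alpha> \<delta> \<epsilon> :: "'a::infinite ordinal"
  assumes "\<delta> < \<epsilon>"
  shows "\<alpha> * \<delta> + \<alpha> \<le> \<alpha> * \<epsilon>"
  using assms ordinal_mult_le_iff by blast

lemma ordinal_division:
  fixes \<alpha> \<beta> \<xi> :: "'a::infinite ordinal"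
  assumes "\<xi> < \<alpha> * \<beta>"
  obtains \<delta> \<rho> where "\<delta> < \<beta>" "\<rho> < \<alpha>" "\<xi> = \<alpha> * \<delta> + \<rho>"
proof -
  define \<delta> where "\<delta> = (LEAST \<delta>. \<xi> < \<alpha> * \<delta> + \<alpha>)"
  obtain \<delta>' where \<delta>': "\<delta>' < \<beta>" "\<xi> < \<alpha> * \<delta>' + \<alpha>"
    using assms ordinal_less_mult_iff by blast
  have \<delta>: "\<xi> < \<alpha> * \<delta> + \<alpha>"
    unfolding \<delta>_def by (rule LeastI) (rule \<delta>'(2))
  have "\<delta> \<le> \<delta>'"
    unfolding \<delta>_def by (rule Least_le) (rule \<delta>'(2))
  then have "\<delta> < \<beta>"
    using \<delta>' by simp
  have "\<alpha> * \<epsilon> + \<alpha> \<le> \<xi>" if "\<epsilon> < \<delta>" for \<epsilon>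
    using not_less_Least[OF that[unfolded \<delta>_def]] by (simp add: not_less)
  then have "\<alpha> * \<delta> \<le> \<xi>"
    by (simp add: ordinal_mult_le_iff)
  then obtain \<rho> where \<rho>: "\<xi> = \<alpha> * \<delta> + \<rho>"
    by (rule ordinal_le_imp_add)
  then have "\<rho> < \<alpha>"
    using \<delta> by simp
  with \<open>\<delta> < \<beta>\<close> \<rho> show thesis
    using that by blast
qed

lemma ordinal_division_unique:
  fixes \<alpha> \<delta> \<delta>' \<rho> \<rho>' :: "'a::infinite ordinal"
  assumes eq: "\<alpha> * \<delta> + \<rho> = \<alpha> * \<delta>' + \<rho>'" and "\<rho> < \<alpha>" "\<rho>' < \<alpha>"
  shows "\<delta> = \<delta>' \<and> \<rho> = \<rho>'"
proof -
  have less: "\<alpha> * \<delta> + \<rho> < \<alpha> * \<delta>' + \<rho>'" if "\<delta> < \<delta>'" "\<rho> < \<alpha>" for \<delta> \<delta>' \<rho> \<rho>'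
    using that by (meson less_le_trans ordinal_add_left_less ordinal_le_add_left
        ordinal_mult_add_le)
  have "\<delta> = \<delta>'"
    using less[of \<delta> \<delta>' \<rho> \<rho>'] less[of \<delta>' \<delta> \<rho>' \<rho>] assms by (metis neqE order.irrefl)
  then show ?thesis
    using eq by (metis neqE ordinal_add_left_less order.irrefl)
qed

primrec ordinal_of_nat :: "nat \<Rightarrow> 'a::infinite ordinal" where
  "ordinal_of_nat 0 = 0"
| "ordinal_of_nat (Suc n) = ordinal_of_nat n + 1"

lemma strict_mono_ordinal_of_nat: "strict_mono (ordinal_of_nat :: nat \<Rightarrow> 'a::infinite ordinal)"
  by (simp add: strict_mono_Suc_iff)

lemma ordinal_below_ordinal_of_nat:
  "\<xi> < ordinal_of_nat n \<Longrightarrow> \<xi> \<in> ordinal_of_nat ` {..<n}"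
  by (induction n) (auto simp: lessThan_Suc order.order_iff_strict)

text \<open>
  An ordinal outside the range of the finite ordinals lies above all of them and hence has
  infinitely many predecessors. Such an ordinal exists because \<open>'a\<close> is infinite, so the
  type \<open>'a ordinal\<close> has strict upper bounds for countable sets.
\<close>

lemma lessThan_omega: "{..<omega :: 'a::infinite ordinal} = range ordinal_of_nat"
proof -
  let ?N = "range ordinal_of_nat :: 'a ordinal set"
  have inf: "infinite ?N"
    by (simp add: strict_mono_ordinal_of_nat strict_mono_imp_inj_on finite_image_iff)
  have above: "ordinal_of_nat n < \<xi>" if "\<xi> \<notin> ?N" for \<xi> :: "'a ordinal" and n
    using that ordinal_below_ordinal_of_nat[of \<xi> n] by (metis imageE linorder_neqE rangeI)
  have "|UNIV :: nat set| \<le>o |UNIV :: 'a set|"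
    using infinite_UNIV infinite_iff_card_of_nat by blast
  then obtain \<gamma> where "\<forall>n. ordinal_of_nat n < (\<gamma> :: 'a ordinal)"
    using ordinal_strict_upper_bound[of "UNIV :: nat set" ordinal_of_nat] by blast
  then have "?N \<subseteq> {..<\<gamma>}"
    by auto
  then have "infinite {..<\<gamma>}"
    using inf finite_subset by blast
  then have om: "infinite {..<omega :: 'a ordinal}"
    unfolding omega_def by (rule LeastI)
  have "\<xi> \<in> ?N" if "\<xi> < omega" for \<xi>
  proof (rule ccontr)
    assume "\<xi> \<notin> ?N"
    then have "?N \<subseteq> {..<\<xi>}"
      using above by auto
    then have "infinite {..<\<xi>}"
      using inf finite_subset by blast
    then show False
      using that not_less_Least unfolding omega_def by blast
  qed
  moreover have "ordinal_of_nat n < (omega :: 'a ordinal)" for n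
  proof (rule ccontr)
    assume "\<not> ordinal_of_nat n < (omega :: 'a ordinal)"
    then have "{..<omega :: 'a ordinal} \<subseteq> ordinal_of_nat ` {..<n}"
      using ordinal_below_ordinal_of_nat[where 'a = 'a, of _ n] by (auto simp: not_less)
    then show False
      using om finite_subset by blast
  qed
  ultimately show ?thesis
    by auto
qed

lemma ordinal_of_nat_less_omega [simp]: "ordinal_of_nat n < omega"
  using lessThan_omega by auto

lemma less_omega_add_one: "\<xi> < omega \<Longrightarrow> \<xi> + 1 < omega"
  by (metis imageE lessThan_iff lessThan_omega ordinal_of_nat.simps(2) rangeI)

lemma omega_power_pos: "(0 :: 'a::infinite ordinal) < omega ^ k"
proof (induction k)
  case 0
  then show ?case
    by simp
next
  case (Suc k)
  have "0 < omega ^ k * (0 :: 'a ordinal) + omega ^ k"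
    using Suc by simp
  also have "\<dots> \<le> omega ^ k * omega"
    using ordinal_of_nat_less_omega[of 0] by (intro ordinal_mult_add_le) simp
  finally show ?case
    by (simp add: power_commutes)
qed

lemma ordinal_mult_Suc: "\<beta> * ordinal_of_nat (Suc n) = \<beta> * ordinal_of_nat n + \<beta>"
  by (simp add: ordinal_distrib_left)

lemma less_add_mult_omega:
  fixes \<alpha> \<beta> \<zeta> :: "'a::infinite ordinal"
  assumes "\<zeta> < \<alpha> + \<beta> * omega"
  obtains n where "\<zeta> < \<alpha> + \<beta> * ordinal_of_nat n + \<beta>"
proof (cases "\<zeta> < \<alpha>")
  case True
  then have "\<zeta> < \<alpha> + \<beta> * ordinal_of_nat 0 + \<beta>"
    by (metis less_le_trans ordinal_le_add_left)
  then show thesis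
    by (rule that)
next
  case False
  then obtain \<delta> where \<delta>: "\<delta> < \<beta> * omega" "\<zeta> \<le> \<alpha> + \<delta>"
    using assms ordinal_less_add_iff by blast
  then obtain n where "\<delta> < \<beta> * ordinal_of_nat n + \<beta>"
    using ordinal_less_mult_iff lessThan_omega by (metis imageE lessThan_iff)
  then show thesis
    using that[of n] \<delta> by (metis add.assoc le_less_trans ordinal_add_left_less)
qed

lemma add_mult_less_omega:
  fixes \<alpha> \<beta> :: "'a::infinite ordinal"
  assumes "0 < \<beta>"
  shows "\<alpha> + \<beta> * ordinal_of_nat n + \<beta> < \<alpha> + \<beta> * omega"
proof -
  have "\<beta> * ordinal_of_nat (Suc n) < \<beta> * ordinal_of_nat (Suc n) + \<beta>"
    using assms by simp
  also have "\<dots> \<le> \<beta> * omega"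
    by (intro ordinal_mult_add_le ordinal_of_nat_less_omega)
  finally show ?thesis
    unfolding ordinal_mult_Suc by (simp add: add.assoc)
qed


section \<open>Closed copies of \<open>\<omega> + 1\<close>\<close>

text \<open>
  The preimage under the inverse of a ray is the trace of a ray on the image of
  \<open>g\<close>, and rays generate the topology of an ordinal. The domain must be an initial segment:
  a ray that starts outside of it is then trivial, whereas at a gap in the domain a ray could
  pull back to a set that is not open.
\<close>

lemma strict_mono_on_ordinal_inverse_continuous:
  fixes g :: "'a ordinal \<Rightarrow> 'b::linorder_topology"
  assumes g: "strict_mono_on {..<\<beta>} g"
  shows "continuous_on (g ` {..<\<beta>}) (inv_into {..<\<beta>} g)"
proof (rule continuous_on_generate_topology[OF open_generated_order], safe)
  have inv: "inv_into {..<\<beta>} g (g \<xi>) = \<xi>" if "\<xi> < \<beta>" for \<xi>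
    using strict_mono_on_imp_inj_on[OF g] that by simp
  have less: "g \<xi> < g \<eta> \<longleftrightarrow> \<xi> < \<eta>" if "\<xi> < \<beta>" "\<eta> < \<beta>" for \<xi> \<eta>
    using strict_mono_on_less[OF g] that by simp
  fix \<eta> :: "'a ordinal"
  show "\<exists>C. open C \<and> C \<inter> g ` {..<\<beta>} = inv_into {..<\<beta>} g -` {..<\<eta>} \<inter> g ` {..<\<beta>}"
  proof (cases "\<eta> < \<beta>")
    case True
    then show ?thesis
      by (intro exI[of _ "{..<g \<eta>}"]) (auto simp: inv less)
  next
    case False
    then show ?thesis
      by (intro exI[of _ UNIV]) (auto simp: inv)
  qed
  show "\<exists>C. open C \<and> C \<inter> g ` {..<\<beta>} = inv_into {..<\<beta>} g -` {\<eta><..} \<inter> g ` {..<\<beta>}"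
  proof (cases "\<eta> < \<beta>")
    case True
    then show ?thesis
      by (intro exI[of _ "{g \<eta><..}"]) (auto simp: inv less)
  next
    case False
    then show ?thesis
      by (intro exI[of _ "{}"]) (auto simp: inv)
  qed
qed

text \<open>
  The order-isomorphism \<open>g\<close> from \<open>\<omega> + 1\<close> is extended by the constant
  \<open>\<theta>\<close> to a monotone function on all ordinals. This makes its continuity a matter of whole
  rays: initial segments are always open, and final segments are open if their least element is
  not a limit.
\<close>

lemma order_homeomorphic_omega_add_one:
  fixes s :: "nat \<Rightarrow> 'a::infinite ordinal"
  assumes s: "strict_mono s" and below: "\<And>n. s n < \<theta>" and cofinal: "\<And>\<zeta>. \<zeta> < \<theta> \<Longrightarrow> \<exists>n. \<zeta> < s n"
  shows "order_homeomorphic (insert \<theta> (range s)) {..<omega + 1 :: 'a ordinal}"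
proof -
  let ?I = "{..<omega + 1 :: 'a ordinal}"
  define g where "g \<xi> = (if \<xi> < omega then s (inv ordinal_of_nat \<xi>) else \<theta>)" for \<xi> :: "'a ordinal"
  have inj: "inj (ordinal_of_nat :: nat \<Rightarrow> 'a ordinal)"
    by (rule strict_mono_imp_inj_on[OF strict_mono_ordinal_of_nat])
  have g_nat [simp]: "g (ordinal_of_nat n) = s n" for n
    by (simp add: g_def inv_f_f[OF inj])
  have g_lim: "g \<xi> = \<theta>" if "omega \<le> \<xi>" for \<xi>
    using that by (simp add: g_def leD)
  have nat: "\<exists>n. \<xi> = ordinal_of_nat n" if "\<xi> < omega" for \<xi> :: "'a ordinal"
    using that lessThan_omega by auto
  have mono: "g \<xi> \<le> g \<eta>" if "\<xi> \<le> \<eta>" for \<xi> \<eta>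
  proof (cases "\<eta> < omega")
    case True
    then obtain m n where "\<xi> = ordinal_of_nat m" "\<eta> = ordinal_of_nat n"
      using nat \<open>\<xi> \<le> \<eta>\<close> le_less_trans by metis
    then show ?thesis
      using that by (simp add: strict_mono_less_eq[OF s] strict_mono_less_eq[OF strict_mono_ordinal_of_nat])
  next
    case False
    then show ?thesis
      using nat[of \<xi>] below g_lim by (metis g_nat leI order.refl order_less_imp_le)
  qed
  have strict: "strict_mono_on ?I g"
  proof (rule strict_mono_onI)
    fix \<xi> \<eta> :: "'a ordinal"
    assume "\<eta> \<in> ?I" "\<xi> < \<eta>"
    then have "\<xi> < omega"
      by auto
    then obtain m where m: "\<xi> = ordinal_of_nat m"
      using nat by blast
    have "g \<xi> < g (\<xi> + 1)"
      using s strict_mono_Suc_iff m g_nat by (metis ordinal_of_nat.simps(2))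
    also have "\<dots> \<le> g \<eta>"
      using \<open>\<xi> < \<eta>\<close> by (intro mono) (simp add: ordinal_add_one_le_iff)
    finally show "g \<xi> < g \<eta>" .
  qed
  have image: "g ` ?I = insert \<theta> (range s)"
  proof (intro equalityI subsetI)
    fix x assume "x \<in> insert \<theta> (range s)"
    then show "x \<in> g ` ?I"
    proof
      assume "x = \<theta>"
      then show ?thesis
        using g_lim[of omega] by (intro image_eqI[of _ _ omega]) auto
    next
      assume "x \<in> range s"
      then obtain n where "x = g (ordinal_of_nat n)"
        by auto
      then show ?thesis
        by (auto intro!: image_eqI simp: less_imp_le simp del: g_nat)
    qed
  next
    fix x assume "x \<in> g ` ?I"
    then show "x \<in> insert \<theta> (range s)"
      using nat g_lim by (auto simp: g_def)
  qed
  have "continuous_on UNIV g"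
  proof (rule continuous_on_generate_topology[OF open_generated_order], safe)
    fix \<zeta> :: "'a ordinal"
    show "\<exists>C. open C \<and> C \<inter> UNIV = g -` {..<\<zeta>} \<inter> UNIV"
    proof (cases "\<exists>\<xi>. \<zeta> \<le> g \<xi>")
      case True
      define \<mu> where "\<mu> = (LEAST \<xi>. \<zeta> \<le> g \<xi>)"
      have "\<zeta> \<le> g \<mu>"
        unfolding \<mu>_def using True by (rule LeastI_ex)
      moreover have "g \<xi> < \<zeta>" if "\<xi> < \<mu>" for \<xi>
        using not_less_Least[OF that[unfolded \<mu>_def]] by (simp add: not_le)
      moreover have "\<zeta> \<le> g \<xi>" if "\<mu> \<le> \<xi>" for \<xi>
        using \<open>\<zeta> \<le> g \<mu>\<close> mono[OF that] by (rule order_trans)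
      ultimately have "{..<\<mu>} = g -` {..<\<zeta>}"
        by (auto simp: not_le[symmetric])
      then show ?thesis
        by (metis Int_UNIV_right open_lessThan)
    next
      case False
      then have "g -` {..<\<zeta>} = UNIV"
        by (auto simp: not_le)
      then show ?thesis
        by (metis Int_UNIV_right open_UNIV)
    qed
    show "\<exists>C. open C \<and> C \<inter> UNIV = g -` {\<zeta><..} \<inter> UNIV"
    proof (cases "\<zeta> < \<theta>")
      case True
      define m where "m = (LEAST n. \<zeta> < s n)"
      have m: "\<zeta> < s m"
        unfolding m_def using cofinal[OF True] by (rule LeastI_ex)
      have above: "\<zeta> < g \<xi>" if "ordinal_of_nat m \<le> \<xi>" for \<xi>
        using mono[OF that] m by simp
      \<comment> \<open>The least index past \<open>\<zeta>\<close> is finite, hence zero or a successor, and so the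
        final segment it generates is open. This is where cofinality enters.\<close>
      show ?thesis
      proof (cases m)
        case 0
        then have "g -` {\<zeta><..} = UNIV"
          using above by auto
        then show ?thesis
          by (metis Int_UNIV_right open_UNIV)
      next
        case (Suc p)
        then have "s p \<le> \<zeta>"
          using not_less_Least[of p "\<lambda>n. \<zeta> < s n"] by (simp add: m_def not_less)
        then have "g \<xi> \<le> \<zeta>" if "\<xi> \<le> ordinal_of_nat p" for \<xi>
          using mono[OF that] by simp
        moreover have "\<zeta> < g \<xi>" if "ordinal_of_nat p < \<xi>" for \<xi>
          using that Suc by (intro above) (simp add: ordinal_add_one_le_iff)
        ultimately have "{ordinal_of_nat p<..} = g -` {\<zeta><..}"
          by (auto simp: not_le[symmetric])
        then show ?thesis
          by (metis Int_UNIV_right open_greaterThan)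
      qed
    next
      case False
      have g_le: "g \<xi> \<le> \<theta>" for \<xi>
        using mono[of \<xi> "max \<xi> omega"] g_lim[of "max \<xi> omega"] by simp
      have "g -` {\<zeta><..} = {}"
        using False less_le_trans[OF _ g_le] by auto
      then show ?thesis
        by (metis Int_UNIV_right open_empty)
    qed
  qed
  then have "continuous_on ?I g"
    by (rule continuous_on_subset) simp
  then have "homeomorphism (g ` ?I) ?I (inv_into ?I g) g"
    using strict_mono_on_imp_inj_on[OF strict]
    by (intro homeomorphismI strict_mono_on_ordinal_inverse_continuous[OF strict])
      (auto intro: inv_into_into simp: f_inv_into_f)
  moreover have "strict_mono_on (g ` ?I) (inv_into ?I g)"
    using strict_mono_on_imp_inj_on[OF strict] strict_mono_on_less[OF strict]
    by (auto intro!: strict_mono_onI)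
  ultimately show ?thesis
    unfolding order_homeomorphic_def image by blast
qed


section \<open>The upper bound\<close>

lemma strict_mono_cofinal_sequence:
  fixes R :: "'a::linorder set" and t :: "nat \<Rightarrow> 'a"
  assumes t: "\<And>n. t n < \<theta>" "\<And>\<zeta>. \<zeta> < \<theta> \<Longrightarrow> \<exists>n. \<zeta> < t n"
    and R: "\<And>\<zeta>. \<zeta> < \<theta> \<Longrightarrow> \<exists>r\<in>R. \<zeta> < r \<and> r < \<theta>"
  obtains s :: "nat \<Rightarrow> 'a" where "strict_mono s" "range s \<subseteq> R" "\<And>n. t n < s n" "\<And>n. s n < \<theta>"
proof -
  have "\<exists>s. \<forall>n. (s n \<in> R \<and> t n < s n \<and> s n < \<theta>) \<and> s n < s (Suc n)"
  proof (rule dependent_nat_choice)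
    show "\<exists>x. x \<in> R \<and> t 0 < x \<and> x < \<theta>"
      using R[OF t(1)[of 0]] by blast
    show "\<exists>y. (y \<in> R \<and> t (Suc n) < y \<and> y < \<theta>) \<and> x < y" if "x \<in> R \<and> t n < x \<and> x < \<theta>" for x n
      using R[of "max x (t (Suc n))"] that t(1) by auto
  qed
  then show thesis
    using that by (auto simp: strict_mono_Suc_iff)
qed

text \<open>
  Ramsey's theorem thins a cofinal \<open>\<omega>\<close>-sequence to a homogeneous one. If it is red, the
  limit \<open>\<theta>\<close> completes it to a closed copy of \<open>\<omega> + 1\<close>, because all edges
  to \<open>\<theta>\<close> are red.
\<close>

lemma red_omega_add_one_or_blue_clique:
  fixes s :: "nat \<Rightarrow> 'a::infinite ordinal" and c :: "'a ordinal set \<Rightarrow> color"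
  assumes s: "strict_mono s" and below: "\<And>n. s n < \<theta>" and cofinal: "\<And>\<zeta>. \<zeta> < \<theta> \<Longrightarrow> \<exists>n. \<zeta> < s n"
    and red: "\<And>n. c {s n, \<theta>} = Red"
  shows "(\<exists>X \<subseteq> insert \<theta> (range s). order_homeomorphic X {..<omega + 1 :: 'a ordinal} \<and>
            (\<forall>e \<in> [X]\<^bsup>2\<^esup>. c e = Red)) \<or>
         (\<exists>Y \<in> [range s]\<^bsup>k\<^esup>. \<forall>e \<in> [Y]\<^bsup>2\<^esup>. c e = Blue)"
proof -
  define f :: "nat set \<Rightarrow> nat" where "f e = (if c (s ` e) = Red then 0 else 1)" for e
  have "\<exists>Y t. Y \<subseteq> UNIV \<and> infinite Y \<and> t < 2 \<and> (\<forall>x\<in>Y. \<forall>y\<in>Y. x \<noteq> y \<longrightarrow> f {x, y} = t)"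
    by (rule Ramsey2) (auto simp: f_def)
  then obtain Y t where Y: "infinite Y" "\<forall>x\<in>Y. \<forall>y\<in>Y. x \<noteq> y \<longrightarrow> f {x, y} = t"
    by blast
  show ?thesis
  proof (cases "t = 0")
    case True
    have red_Y: "c {s x, s y} = Red" if "x \<in> Y" "y \<in> Y" "x \<noteq> y" for x y
      using Y(2) that True by (auto simp: f_def split: if_splits)
    define u where "u = s \<circ> enumerate Y"
    have u: "u n \<in> s ` Y" for n
      using enumerate_in_set[OF Y(1)] by (simp add: u_def)
    have "strict_mono u"
      unfolding u_def using s strict_mono_enumerate[OF Y(1)] by (rule strict_mono_o)
    moreover have "u n < \<theta>" for n
      using below by (simp add: u_def)
    moreover have "\<exists>n. \<zeta> < u n" if "\<zeta> < \<theta>" for \<zeta>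
    proof -
      obtain n where "\<zeta> < s n"
        using cofinal \<open>\<zeta> < \<theta>\<close> by blast
      also have "s n \<le> u n"
        using le_enumerate[OF Y(1)] by (simp add: u_def strict_mono_less_eq[OF s])
      finally show ?thesis
        by blast
    qed
    ultimately have "order_homeomorphic (insert \<theta> (range u)) {..<omega + 1 :: 'a ordinal}"
      by (rule order_homeomorphic_omega_add_one)
    moreover have "c e = Red" if e2: "e \<in> [insert \<theta> (range u)]\<^bsup>2\<^esup>" for e
    proof -
      have "insert \<theta> (range u) \<subseteq> insert \<theta> (s ` Y)"
        using u by auto
      then have "e \<in> [insert \<theta> (s ` Y)]\<^bsup>2\<^esup>"
        using e2 nsets_mono by blast
      then obtain x y where e: "e = {x, y}" "x \<in> insert \<theta> (s ` Y)" "y \<in> insert \<theta> (s ` Y)" "x \<noteq> y"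
        unfolding nsets_2_eq by blast
      have "c {\<theta>, s n} = Red" for n
        using red[of n] by (simp add: insert_commute)
      then show ?thesis
        using e red red_Y by auto
    qed
    moreover have "insert \<theta> (range u) \<subseteq> insert \<theta> (range s)"
      by (auto simp: u_def)
    ultimately show ?thesis
      by blast
  next
    case False
    obtain B where B: "finite B" "card B = k" "B \<subseteq> Y"
      using infinite_arbitrarily_large[OF Y(1)] by blast
    have inj: "inj_on s B"
      using s by (meson inj_on_subset strict_mono_imp_inj_on subset_UNIV)
    have "c {s x, s y} = Blue" if "x \<in> B" "y \<in> B" "x \<noteq> y" for x y
    proof -
      have "f {x, y} = t"
        using Y(2) B(3) that by blast
      then have "c {s x, s y} \<noteq> Red"
        using False by (auto simp: f_def)
      then show ?thesis
        by (cases "c {s x, s y}") auto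
    qed
    then have "\<forall>e \<in> [s ` B]\<^bsup>2\<^esup>. c e = Blue"
      unfolding nsets_2_eq by auto
    moreover have "s ` B \<in> [range s]\<^bsup>k\<^esup>"
      using B inj by (auto simp: nsets_def card_image)
    ultimately show ?thesis
      by blast
  qed
qed

text \<open>
  Starting the induction at \<open>k = 0\<close>, where a single point is a blue clique, makes the
  case of \<open>\<omega> + 1\<close> an instance of the induction step.
\<close>

lemma interval_omega_power_ramsey:
  fixes \<alpha> :: "'a::infinite ordinal" and c :: "'a ordinal set \<Rightarrow> color"
  shows "(\<exists>X \<subseteq> {\<alpha>..\<alpha> + omega ^ k}. order_homeomorphic X {..<omega + 1 :: 'a ordinal} \<and>
            (\<forall>e \<in> [X]\<^bsup>2\<^esup>. c e = Red)) \<or>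
         (\<exists>Y \<in> [{\<alpha>..\<alpha> + omega ^ k}]\<^bsup>(k + 1)\<^esup>. \<forall>e \<in> [Y]\<^bsup>2\<^esup>. c e = Blue)"
proof (induction k arbitrary: \<alpha>)
  case 0
  have "{\<alpha>} \<in> [{\<alpha>..\<alpha> + omega ^ 0}]\<^bsup>(0 + 1)\<^esup>"
    by (simp add: nsets_def)
  moreover have "[{\<alpha>}]\<^bsup>2\<^esup> = {}"
    by (auto simp: nsets_2_eq)
  ultimately show ?case
    by blast
next
  case (Suc k)
  define \<beta> :: "'a ordinal" where "\<beta> = omega ^ k"
  define \<theta> where "\<theta> = \<alpha> + \<beta> * omega"
  \<comment> \<open>The points \<open>t n\<close> witness that \<open>\<theta>\<close> has countable cofinality. They also divide a final
    segment below \<open>\<theta>\<close> into blocks \<open>[t n, t n + \<beta>]\<close>, to which the induction hypothesis applies.\<close>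
  define t where "t n = \<alpha> + \<beta> * ordinal_of_nat n + \<beta>" for n
  have \<theta>: "\<alpha> + omega ^ Suc k = \<theta>"
    by (simp add: \<theta>_def \<beta>_def power_commutes)
  have "0 < \<beta>"
    by (simp add: \<beta>_def omega_power_pos)
  then have t_less: "t n < \<theta>" for n
    unfolding t_def \<theta>_def by (rule add_mult_less_omega)
  have t_cofinal: "\<exists>n. \<zeta> < t n" if "\<zeta> < \<theta>" for \<zeta>
    using that unfolding t_def \<theta>_def by (rule less_add_mult_omega) blast
  have t_Suc: "t (Suc n) = t n + \<beta>" for n
    unfolding t_def ordinal_mult_Suc by (simp add: add.assoc)
  have t_ge: "\<alpha> \<le> t n" for n
    by (simp add: t_def add.assoc)
  define R where "R = {\<xi>. \<alpha> \<le> \<xi> \<and> \<xi> < \<theta> \<and> c {\<xi>, \<theta>} = Red}"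
  show ?case
  proof (cases "\<forall>\<zeta><\<theta>. \<exists>r\<in>R. \<zeta> < r")
    case True
    then have "\<exists>r\<in>R. \<zeta> < r \<and> r < \<theta>" if "\<zeta> < \<theta>" for \<zeta>
      using that by (auto simp: R_def)
    with t_less t_cofinal obtain s
      where s: "strict_mono s" "range s \<subseteq> R" "\<And>n. t n < s n" "\<And>n. s n < \<theta>"
      by (rule strict_mono_cofinal_sequence) auto
    have "\<exists>n. \<zeta> < s n" if "\<zeta> < \<theta>" for \<zeta>
      using t_cofinal[OF that] s(3) less_trans by blast
    moreover have "c {s n, \<theta>} = Red" for n
      using s(2) by (auto simp: R_def)
    ultimately have
      "(\<exists>X \<subseteq> insert \<theta> (range s). order_homeomorphic X {..<omega + 1 :: 'a ordinal} \<and>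
          (\<forall>e \<in> [X]\<^bsup>2\<^esup>. c e = Red)) \<or>
       (\<exists>Y \<in> [range s]\<^bsup>(Suc k + 1)\<^esup>. \<forall>e \<in> [Y]\<^bsup>2\<^esup>. c e = Blue)"
      by (rule red_omega_add_one_or_blue_clique[OF s(1) s(4)])
    moreover have sub: "insert \<theta> (range s) \<subseteq> {\<alpha>..\<theta>}"
      using s(2) by (auto simp: R_def \<theta>_def)
    moreover have "[range s]\<^bsup>(Suc k + 1)\<^esup> \<subseteq> [{\<alpha>..\<theta>}]\<^bsup>(Suc k + 1)\<^esup>"
      using sub by (intro nsets_mono) blast
    ultimately show ?thesis
      unfolding \<theta> by (meson subsetD subset_trans)
  next
    case False
    then obtain \<zeta> where \<zeta>: "\<zeta> < \<theta>" "\<And>r. r \<in> R \<Longrightarrow> r \<le> \<zeta>"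
      by (auto simp: not_less)
    obtain n where n: "\<zeta> < t n"
      using t_cofinal[OF \<zeta>(1)] by blast
    let ?J = "{t n..t n + \<beta>}"
    have J: "\<alpha> \<le> \<xi>" "\<xi> < \<theta>" if "\<xi> \<in> ?J" for \<xi>
      using that t_ge[of n] t_less[of "Suc n"] by (auto simp: t_Suc)
    have blue: "c {\<xi>, \<theta>} = Blue" if "\<xi> \<in> ?J" for \<xi>
    proof (cases "c {\<xi>, \<theta>}")
      case Red
      then have "\<xi> \<in> R"
        using J that by (simp add: R_def)
      then show ?thesis
        using \<zeta>(2) n that by fastforce
    qed
    have sub: "?J \<subseteq> {\<alpha>..\<theta>}"
      using J by (auto simp: less_imp_le)
    consider X where "X \<subseteq> ?J" "order_homeomorphic X {..<omega + 1 :: 'a ordinal}"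
        "\<forall>e \<in> [X]\<^bsup>2\<^esup>. c e = Red"
      | Y where "Y \<in> [?J]\<^bsup>(k + 1)\<^esup>" "\<forall>e \<in> [Y]\<^bsup>2\<^esup>. c e = Blue"
      using Suc.IH[of "t n"] unfolding \<beta>_def by blast
    then show ?thesis
    proof cases
      case 1
      then show ?thesis
        unfolding \<theta> using sub by blast
    next
      case 2
      have "Y \<subseteq> ?J" "finite Y" "card Y = k + 1"
        using 2(1) by (auto simp: nsets_def)
      moreover have "\<theta> \<notin> Y"
        using \<open>Y \<subseteq> ?J\<close> J(2) by blast
      moreover have "insert \<theta> Y \<subseteq> {\<alpha>..\<theta>}"
        using order_trans[OF \<open>Y \<subseteq> ?J\<close> sub] by (simp add: \<theta>_def)
      ultimately have "insert \<theta> Y \<in> [{\<alpha>..\<theta>}]\<^bsup>(Suc k + 1)\<^esup>"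
        by (simp add: nsets_def)
      moreover have "c e = Blue" if e2: "e \<in> [insert \<theta> Y]\<^bsup>2\<^esup>" for e
      proof -
        obtain x y where e: "e = {x, y}" "x \<in> insert \<theta> Y" "y \<in> insert \<theta> Y" "x \<noteq> y"
          using e2 unfolding nsets_2_eq by blast
        have \<theta>_Y: "c {\<xi>, \<theta>} = Blue" "c {\<theta>, \<xi>} = Blue" if "\<xi> \<in> Y" for \<xi>
          using that blue[of \<xi>] \<open>Y \<subseteq> ?J\<close> by (auto simp: insert_commute)
        have "c {\<xi>, \<eta>} = Blue" if "\<xi> \<in> Y" "\<eta> \<in> Y" "\<xi> \<noteq> \<eta>" for \<xi> \<eta>
          using that 2(2) by simp
        then show ?thesis
          using e \<theta>_Y by auto
      qed
      ultimately show ?thesis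
        unfolding \<theta> by blast
    qed
  qed
qed

lemma closed_ramsey_omega_power:
  "closed_ramsey (omega ^ k + 1 :: 'a::infinite ordinal) (omega + 1) (k + 1)"
  unfolding closed_ramsey_def
proof
  fix c :: "'a ordinal set \<Rightarrow> color"
  have "{0..0 + omega ^ k} = {..<omega ^ k + 1 :: 'a ordinal}"
    by auto
  then show "(\<exists>X \<subseteq> {..<omega ^ k + 1}. order_homeomorphic X {..<omega + 1 :: 'a ordinal} \<and>
               (\<forall>e \<in> [X]\<^bsup>2\<^esup>. c e = Red)) \<or>
             (\<exists>Y \<in> [{..<omega ^ k + 1}]\<^bsup>(k + 1)\<^esup>. \<forall>e \<in> [Y]\<^bsup>2\<^esup>. c e = Blue)"
    using interval_omega_power_ramsey[of 0 k c] by (simp only:)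
qed

lemma order_homeomorphic_imp_homeomorphic: "order_homeomorphic X Y \<Longrightarrow> X homeomorphic Y"
  unfolding order_homeomorphic_def homeomorphic_def by blast

lemma closed_ramsey_imp_topological_ramsey:
  assumes "closed_ramsey \<beta> \<alpha> k"
  shows "topological_ramsey \<beta> \<alpha> k"
  unfolding topological_ramsey_def
proof
  fix c
  show "(\<exists>X \<subseteq> {..<\<beta>}. X homeomorphic {..<\<alpha>} \<and> (\<forall>e \<in> [X]\<^bsup>2\<^esup>. c e = Red)) \<or>
        (\<exists>Y \<in> [{..<\<beta>}]\<^bsup>k\<^esup>. \<forall>e \<in> [Y]\<^bsup>2\<^esup>. c e = Blue)"
    using assms[unfolded closed_ramsey_def, rule_format, of c] order_homeomorphic_imp_homeomorphic
    by blast
qed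


section \<open>The lower bound\<close>

text \<open>
  The function \<open>f\<close> is the Cantor--Bendixson rank. It is built by induction on \<open>k\<close>: an
  ordinal \<open>\<omega>\<^sup>k * n + \<rho>\<close> with \<open>0 < \<rho> < \<omega>\<^sup>k\<close> inherits the rank of
  \<open>\<rho>\<close>, and the multiples of \<open>\<omega>\<^sup>k\<close> get the new rank \<open>k\<close>.
  Points of equal rank need to be kept away only from the left, because \<open>\<xi> + 1\<close>
  separates \<open>\<xi>\<close> from all larger ordinals. Zero is left out, since it is a multiple
  of every power of \<open>\<omega>\<close> and nothing lies to its left.
\<close>

lemma omega_power_rank:
  "\<exists>f :: 'a::infinite ordinal \<Rightarrow> nat. \<forall>\<xi>. 0 < \<xi> \<and> \<xi> < omega ^ k \<longrightarrow>
     f \<xi> < k \<and> (\<exists>\<zeta><\<xi>. \<forall>\<eta>. \<zeta> < \<eta> \<and> \<eta> < \<xi> \<longrightarrow> f \<eta> \<noteq> f \<xi>)"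
proof (induction k)
  case 0
  then show ?case
    by auto
next
  case (Suc k)
  define \<alpha> :: "'a ordinal" where "\<alpha> = omega ^ k"
  obtain f :: "'a ordinal \<Rightarrow> nat" where f_disc: "\<forall>\<xi>. 0 < \<xi> \<and> \<xi> < \<alpha> \<longrightarrow>
      f \<xi> < k \<and> (\<exists>\<zeta><\<xi>. \<forall>\<eta>. \<zeta> < \<eta> \<and> \<eta> < \<xi> \<longrightarrow> f \<eta> \<noteq> f \<xi>)"
    using Suc unfolding \<alpha>_def by (rule exE)
  have f: "f \<xi> < k" if "0 < \<xi>" "\<xi> < \<alpha>" for \<xi>
    using f_disc that by simp
  have disc: "\<exists>\<zeta><\<xi>. \<forall>\<eta>. \<zeta> < \<eta> \<and> \<eta> < \<xi> \<longrightarrow> f \<eta> \<noteq> f \<xi>" if "0 < \<xi>" "\<xi> < \<alpha>" for \<xi>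
    using f_disc that by simp
  define rem where "rem \<xi> = (THE \<rho>. \<rho> < \<alpha> \<and> (\<exists>\<delta>. \<xi> = \<alpha> * \<delta> + \<rho>))" for \<xi>
  have rem: "rem (\<alpha> * \<delta> + \<rho>) = \<rho>" if "\<rho> < \<alpha>" for \<delta> \<rho>
    unfolding rem_def
  proof (rule the_equality)
    show "\<rho> < \<alpha> \<and> (\<exists>\<delta>'. \<alpha> * \<delta> + \<rho> = \<alpha> * \<delta>' + \<rho>)"
      using that by blast
    show "\<rho>' = \<rho>" if "\<rho>' < \<alpha> \<and> (\<exists>\<delta>'. \<alpha> * \<delta> + \<rho> = \<alpha> * \<delta>' + \<rho>')" for \<rho>'
      using that \<open>\<rho> < \<alpha>\<close> ordinal_division_unique[of \<alpha> \<delta> \<rho> _ \<rho>'] by auto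
  qed
  define g where "g \<xi> = (if rem \<xi> = 0 then k else f (rem \<xi>))" for \<xi>
  have "g \<xi> < Suc k \<and> (\<exists>\<zeta><\<xi>. \<forall>\<eta>. \<zeta> < \<eta> \<and> \<eta> < \<xi> \<longrightarrow> g \<eta> \<noteq> g \<xi>)"
    if \<xi>: "0 < \<xi>" "\<xi> < omega ^ Suc k" for \<xi>
  proof -
    have "\<xi> < \<alpha> * omega"
      using \<xi> by (simp add: \<alpha>_def power_commutes)
    then obtain \<delta> \<rho> where \<delta>: "\<delta> < omega" "\<rho> < \<alpha>" "\<xi> = \<alpha> * \<delta> + \<rho>"
      by (rule ordinal_division)
    show ?thesis
    proof (cases "\<rho> = 0")
      case True
      then have g\<xi>: "g \<xi> = k"
        using rem[OF \<delta>(2), of \<delta>] \<delta>(3) by (simp add: g_def)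
      have "\<delta> \<noteq> 0"
        using \<xi> \<delta> True by auto
      moreover obtain n where "\<delta> = ordinal_of_nat n"
        using \<delta>(1) lessThan_omega by auto
      ultimately obtain \<epsilon> where \<epsilon>: "\<delta> = \<epsilon> + 1"
        by (cases n) auto
      \<comment> \<open>Strictly between two consecutive multiples of \<open>\<alpha>\<close> all ranks are below \<open>k\<close>.\<close>
      have \<xi>_eq: "\<xi> = \<alpha> * \<epsilon> + \<alpha>"
        using \<delta> \<epsilon> True by (simp add: ordinal_distrib_left)
      have "g \<eta> \<noteq> g \<xi>" if "\<alpha> * \<epsilon> < \<eta>" "\<eta> < \<xi>" for \<eta>
      proof -
        have "\<alpha> * \<epsilon> \<le> \<eta>"
          using that(1) by simp
        then obtain \<sigma> where \<sigma>: "\<eta> = \<alpha> * \<epsilon> + \<sigma>"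
          by (rule ordinal_le_imp_add)
        then have "\<sigma> < \<alpha>" "0 < \<sigma>"
          using that \<xi>_eq by simp_all
        then have "g \<eta> < k"
          using f by (simp add: g_def \<sigma> rem)
        then show ?thesis
          using g\<xi> by simp
      qed
      moreover have "\<alpha> * \<epsilon> < \<xi>"
        unfolding \<xi>_eq \<alpha>_def by (simp add: omega_power_pos)
      ultimately show ?thesis
        using g\<xi> by auto
    next
      case False
      then have "0 < \<rho>"
        by (simp add: ordinal_zero_less_iff)
      have g\<xi>: "g \<xi> = f \<rho>"
        using rem \<delta> False by (simp add: g_def)
      obtain \<zeta> where \<zeta>: "\<zeta> < \<rho>" "\<And>\<eta>. \<zeta> < \<eta> \<Longrightarrow> \<eta> < \<rho> \<Longrightarrow> f \<eta> \<noteq> f \<rho>"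
        using disc[OF \<open>0 < \<rho>\<close> \<delta>(2)] by blast
      have "g \<eta> \<noteq> g \<xi>" if "\<alpha> * \<delta> + \<zeta> < \<eta>" "\<eta> < \<xi>" for \<eta>
      proof -
        have "\<alpha> * \<delta> \<le> \<eta>"
          using that(1) by (meson less_imp_le order_trans ordinal_le_add_left)
        then obtain \<sigma> where \<sigma>: "\<eta> = \<alpha> * \<delta> + \<sigma>"
          by (rule ordinal_le_imp_add)
        then have \<sigma>': "\<sigma> < \<rho>" "\<zeta> < \<sigma>"
          using that \<delta>(3) by simp_all
        then have "\<sigma> < \<alpha>" "\<sigma> \<noteq> 0"
          using \<delta>(2) by auto
        then have "g \<eta> = f \<sigma>"
          by (simp add: g_def \<sigma> rem)
        then show ?thesis
          using \<zeta>(2) \<sigma>' g\<xi> by simp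
      qed
      moreover have "\<alpha> * \<delta> + \<zeta> < \<xi>"
        using \<zeta>(1) \<delta>(3) by simp
      moreover have "g \<xi> < Suc k"
        using f[OF \<open>0 < \<rho>\<close> \<delta>(2)] g\<xi> by simp
      ultimately show ?thesis
        by blast
    qed
  qed
  then show ?case
    by (intro exI[of _ g]) blast
qed

lemma not_homeomorphic_omega_add_one:
  fixes X :: "'b::topological_space set"
  assumes disc: "\<And>x. x \<in> X \<Longrightarrow> \<exists>U. open U \<and> U \<inter> X = {x}"
  shows "\<not> X homeomorphic {..<omega + 1 :: 'a::infinite ordinal}"
proof
  let ?I = "{..<omega + 1 :: 'a ordinal}"
  assume "X homeomorphic ?I"
  then obtain f g where fg: "homeomorphism X ?I f g"
    unfolding homeomorphic_def by blast
  have om: "omega \<in> ?I"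
    by simp
  have gI: "g ` ?I = X" and inj: "inj_on g ?I" and cont: "continuous_on ?I g"
    using fg unfolding homeomorphism_def by (auto intro: inj_on_inverseI[of _ f])
  have "g omega \<in> X"
    using om gI by blast
  then obtain U where U: "open U" "U \<inter> X = {g omega}"
    using disc by blast
  obtain V where V: "open V" "V \<inter> ?I = g -` U \<inter> ?I"
    using cont U(1) unfolding continuous_on_open_invariant by blast
  have "omega \<in> V"
    using U(2) V(2) om by blast
  then obtain \<zeta> where \<zeta>: "\<zeta> < omega" "{\<zeta><..omega} \<subseteq> V"
    using open_left[OF V(1), of omega 0] ordinal_of_nat_less_omega[of 0] by auto
  have lt: "\<zeta> + 1 < omega"
    by (rule less_omega_add_one[OF \<zeta>(1)])
  then have "\<zeta> + 1 \<in> ?I" "\<zeta> + 1 \<in> V"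
    using \<zeta>(2) by auto
  then have "g (\<zeta> + 1) = g omega"
    using U(2) V(2) gI by blast
  then show False
    using inj om \<open>\<zeta> + 1 \<in> ?I\<close> lt by (metis inj_onD order_less_irrefl)
qed

lemma not_topological_ramsey_omega_power:
  fixes \<beta> :: "'a::infinite ordinal"
  assumes "k > 0" and \<beta>: "\<beta> \<le> omega ^ k"
  shows "\<not> topological_ramsey \<beta> (omega + 1) (k + 1)"
proof -
  obtain f :: "'a ordinal \<Rightarrow> nat" where f_disc: "\<forall>\<xi>. 0 < \<xi> \<and> \<xi> < omega ^ k \<longrightarrow>
      f \<xi> < k \<and> (\<exists>\<zeta><\<xi>. \<forall>\<eta>. \<zeta> < \<eta> \<and> \<eta> < \<xi> \<longrightarrow> f \<eta> \<noteq> f \<xi>)"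
    using omega_power_rank[of k] by (rule exE)
  have f: "f \<xi> < k" if "0 < \<xi>" "\<xi> < omega ^ k" for \<xi>
    using f_disc that by simp
  have disc: "\<exists>\<zeta><\<xi>. \<forall>\<eta>. \<zeta> < \<eta> \<and> \<eta> < \<xi> \<longrightarrow> f \<eta> \<noteq> f \<xi>"
    if "0 < \<xi>" "\<xi> < omega ^ k" for \<xi>
    using f_disc that by simp
  \<comment> \<open>The isolated point zero may join any class, and class \<open>0\<close> exists as \<open>k > 0\<close>.\<close>
  define h where "h \<xi> = (if \<xi> = 0 then 0 else f \<xi>)" for \<xi>
  have h: "h \<xi> < k" if "\<xi> < \<beta>" for \<xi>
    using that f[of \<xi>] \<beta> \<open>k > 0\<close> by (auto simp: h_def ordinal_zero_less_iff dest: less_le_trans)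
  \<comment> \<open>On a pair, injectivity of \<open>h\<close> says that its two points lie in different classes.\<close>
  define c where "c e = (if inj_on h e then Blue else Red)" for e
  have red: "\<not> X homeomorphic {..<omega + 1 :: 'a ordinal}"
    if X: "X \<subseteq> {..<\<beta>}" "\<forall>e \<in> [X]\<^bsup>2\<^esup>. c e = Red" for X
  proof (rule not_homeomorphic_omega_add_one)
    have const: "h \<xi> = h \<eta>" if "\<xi> \<in> X" "\<eta> \<in> X" for \<xi> \<eta>
    proof (cases "\<xi> = \<eta>")
      case False
      then have "c {\<xi>, \<eta>} = Red"
        using X(2) that by simp
      then show ?thesis
        using False by (simp add: c_def split: if_splits)
    qed simp
    fix \<xi> assume "\<xi> \<in> X"
    show "\<exists>U. open U \<and> U \<inter> X = {\<xi>}"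
    proof (cases "\<xi> = 0")
      case True
      have "{..<1} \<inter> X = {\<xi>}"
        using True \<open>\<xi> \<in> X\<close> by auto
      then show ?thesis
        by (metis open_lessThan)
    next
      case False
      have "0 < \<xi>" "\<xi> < omega ^ k"
        using False \<open>\<xi> \<in> X\<close> X(1) \<beta> by (auto simp: ordinal_zero_less_iff)
      then obtain \<zeta> where \<zeta>: "\<zeta> < \<xi>" "\<And>\<eta>. \<zeta> < \<eta> \<Longrightarrow> \<eta> < \<xi> \<Longrightarrow> f \<eta> \<noteq> f \<xi>"
        using disc[of \<xi>] by blast
      have "{\<zeta><..<\<xi> + 1} \<inter> X = {\<xi>}"
      proof (intro equalityI subsetI)
        fix \<eta> assume \<eta>: "\<eta> \<in> {\<zeta><..<\<xi> + 1} \<inter> X"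
        then have "\<eta> \<noteq> 0"
          by auto
        then have "f \<eta> = f \<xi>"
          using const[of \<eta> \<xi>] \<eta> \<open>\<xi> \<in> X\<close> False by (simp add: h_def)
        then show "\<eta> \<in> {\<xi>}"
          using \<zeta>(2)[of \<eta>] \<eta> by (auto simp: order.order_iff_strict)
      qed (use \<zeta>(1) \<open>\<xi> \<in> X\<close> in auto)
      then show ?thesis
        by (metis open_greaterThanLessThan)
    qed
  qed
  have blue: "\<not> (\<forall>e \<in> [Y]\<^bsup>2\<^esup>. c e = Blue)" if Y: "Y \<in> [{..<\<beta>}]\<^bsup>(k + 1)\<^esup>" for Y
  proof
    assume *: "\<forall>e \<in> [Y]\<^bsup>2\<^esup>. c e = Blue"
    have "inj_on h Y"
    proof (rule inj_onI, rule ccontr)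
      fix x y assume xy: "x \<in> Y" "y \<in> Y" "h x = h y" "x \<noteq> y"
      then have "c {x, y} = Blue"
        using * by simp
      then show False
        using xy by (simp add: c_def split: if_splits)
    qed
    moreover have "h ` Y \<subseteq> {..<k}"
      using h Y by (auto simp: nsets_def)
    ultimately have "card Y \<le> k"
      using card_inj_on_le[of h Y "{..<k}"] by simp
    then show False
      using Y by (simp add: nsets_def)
  qed
  show ?thesis
    unfolding topological_ramsey_def using red blue by blast
qed

theorem theorem4p1:
  fixes k :: nat
  assumes "k > 0"
  shows "(\<exists>\<beta> :: 'a::infinite ordinal. topological_ramsey \<beta> (omega + 1) (k + 1)) \<and>
         (\<exists>\<beta> :: 'a ordinal. closed_ramsey \<beta> (omega + 1) (k + 1)) \<and>
         R_top (omega + 1 :: 'a ordinal) (k + 1) = R_cl (omega + 1) (k + 1) \<and>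
         R_cl (omega + 1 :: 'a ordinal) (k + 1) = omega ^ k + 1"
proof -
  have cl: "closed_ramsey (omega ^ k + 1 :: 'a ordinal) (omega + 1) (k + 1)"
    by (rule closed_ramsey_omega_power)
  then have top: "topological_ramsey (omega ^ k + 1 :: 'a ordinal) (omega + 1) (k + 1)"
    by (rule closed_ramsey_imp_topological_ramsey)
  have min: "omega ^ k + 1 \<le> \<beta>" if "topological_ramsey \<beta> (omega + 1) (k + 1)"
    for \<beta> :: "'a ordinal"
    using that not_topological_ramsey_omega_power[OF assms, of \<beta>]
    by (auto simp: ordinal_add_one_le_iff not_le[symmetric])
  have "R_top (omega + 1 :: 'a ordinal) (k + 1) = omega ^ k + 1"
    unfolding R_top_def using top min by (rule Least_equality)
  moreover have "R_cl (omega + 1 :: 'a ordinal) (k + 1) = omega ^ k + 1"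
    unfolding R_cl_def using cl
    by (rule Least_equality) (rule min, rule closed_ramsey_imp_topological_ramsey)
  ultimately show ?thesis
    using cl top by auto
qed

end
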